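(* Let $\alpha\in(\frac14,\frac13]$. There is a universal function $M$ of six nonnegative real variables, increasing in all of them, such that the following holds. Let $T>0$, $\mathbf{X}\in\mathbf{PBRP}^3_\alpha$, $F\in C_b^3(\mathbb{R}^n;\mathbb{R}^n)$, and let $\mathbf{Y}:[0,T]\to(\mathcal{H}^{\le2})^n$ be an $\mathbf{X}$-controlled planarly branched rough path. Let $\mathbf{Z}=F(\mathbf{Y})$ be the $\mathbf{X}$-controlled planarly branched rough path defined by $$\mathbf{Z}^{\mathbb{1}}_t=F(\mathbf{Y}^{\mathbb{1}}_t),\quad \mathbf{Z}^{\bullet_a}_t=F'(\mathbf{Y}^{\mathbb{1}}_t)\mathbf{Y}^{\bullet_a}_t,\quad \mathbf{Z}^{[\bullet_b]_a}_t=F'(\mathbf{Y}^{\mathbb{1}}_t)\mathbf{Y}^{[\bullet_b]_a}_t,$$ $$\mathbf{Z}^{\bullet_a\bullet_b}_t=F'(\mathbf{Y}^{\mathbb{1}}_t)\mathbf{Y}^{\bullet_a\bullet_b}_t+F''(\mathbf{Y}^{\mathbb{1}}_t)(\mathbf{Y}^{\bullet_a}_t,\mathbf{Y}^{\bullet_b}_t),\qquad a,b\in A.$$ Then $$|||\mathbf{Z}|||_{\mathbf{X};\alpha}\le 4d^2\|F\|_{C_b^3}\,M\Big(T,\sum_{a\in A}|\mathbf{Y}_0^{\bullet_a}|,\sum_{a,b\in A}|\mathbf{Y}_0^{\bullet_a\bullet_b}|,\sum_{a,b\in A}|\mathbf{Y}_0^{[\bullet_b]_a}|,|||\mathbf{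Y}|||_{\mathbf{X};\alpha},|||\mathbf{X}|||_\alpha\Big).$$
   Context: Fix integers $d,n\ge1$, a set $A$ with $d$ elements (identified with $\{1,\dots,d\}$), and $\alpha\in(\frac14,\frac13]$. "Universal" means that $M$ does not depend on $T,\mathbf{X},\mathbf{Y},F$. Forests. A planar forest is a finite ordered sequence (word) of planar rooted trees with vertices decorated by $A$; $\mathcal{F}$ is the set of these, $\mathbb{1}$ the empty forest, $|\tau|$ the number of vertices, $\mathcal{F}^{\le k}=\{\tau:|\tau|\le k\}$. For a forest $\tau$ and $a\in A$, $[\tau]_a$ is the tree obtained by grafting the trees of $\tau$, in order from left to right, onto a new root decorated by $a$; $\bullet_a=[\mathbb{1}]_a$. Thus $\mathcal{F}^{\le2}=\{\mathbb{1},\bullet_a,\bullet_a\bullet_b,[\bullet_b]_a : a,b\in A\}$. On $\mathbb{R}\mathcal{F}$, ⧢ is the shuffle product of words whose letters are trees. The coproduct $\Delta$ (Munthe-Kaas–Wright): for a tree $\tau$, $\Delta(\tau)=\tau\otimes\mathbb{1}+\sum_c P^c(\tau)\otimes T^c(\tau)$, where $c$ ranges over left-admissible cuts, i.e. sets of edges such that (1) with each edge $e\in c$, every edge outgoing from the same vertex and to the left of $e$ is in $c$; (2) each path from the root to a leaf contains at most one edge of $c$ ($c=\emptyset$ allowed); $T^c(\tau)$ is the component containing the root, and $P^c(\tau)$ is obtained by keeping the planar order of subtrees cut off from the same vertex and shuffling together the forests cut off from different vertices. For a forest $\omega$, $\Delta(\omega)=(\mathrm{id}\otimes B_-)(\Delta(B_+(\omega))-B_+(\omega)\otimes\mathbb{1})$,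 where $B_+$ grafts all trees of $\omega$ onto a new undecorated root and $B_-$ is its inverse. E.g. $\Delta(\bullet_a\bullet_b)=\mathbb{1}\otimes\bullet_a\bullet_b+\bullet_a\otimes\bullet_b+\bullet_a\bullet_b\otimes\mathbb{1}$. Write $\mathcal{H}^{\le k}=\mathbb{R}\mathcal{F}^{\le k}$, with pairing $\langle\tau,\tau'\rangle=\delta_{\tau,\tau'}$ with its dual $\mathcal{H}^{*\le k}$; the product $\star$ on $\mathcal{H}^{*\le 3}$ is $\langle x\star y,\tau\rangle=\langle x\otimes y,\Delta\tau\rangle$. Rough paths. An $\alpha$-Hölder planarly branched rough path is a map $\mathbf{X}:[0,T]^2\to\mathcal{H}^{*\le3}$, with $\mathbf{X}^\tau_{s,t}:=\langle\mathbf{X}_{s,t},\tau\rangle$, such that for all $s,t,u\in[0,T]$: $\mathbf{X}_{s,u}\star\mathbf{X}_{u,t}=\mathbf{X}_{s,t}$; $\mathbf{X}^{\mathbb{1}}_{s,t}=1$ and $\langle\mathbf{X}_{s,t},\sigma$ ⧢ $\tau\rangle=\mathbf{X}^\sigma_{s,t}\mathbf{X}^\tau_{s,t}$ whenever $|\sigma|+|\tau|\le3$; and $\|\mathbf{X}^\tau\|_{|\tau|\alpha}:=\sup_{s\ne t}|\mathbf{X}^\tau_{s,t}|/|t-s|^{|\tau|\alpha}<\infty$ for $|\tau|\le3$. $\mathbf{PBRP}^3_\alpha$ is the set of these, and $|||\mathbf{X}|||_\alpha:=\sum_{\tau\in\mathcal{F}^{\le3}\setminus\{\mathbb{1}\}}\|\mathbf{X}^\tau\|_{|\tau|\alpha}$.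 Controlled paths. For a path $\mathbf{Y}:[0,T]\to(\mathcal{H}^{\le2})^n$ write $\mathbf{Y}^\tau_t=\langle\tau,\mathbf{Y}_t\rangle\in\mathbb{R}^n$ (coefficient of $\tau$), $\mathbf{Y}^\tau_{s,t}=\mathbf{Y}^\tau_t-\mathbf{Y}^\tau_s$, and $$R\mathbf{Y}^{\mathbb{1}}_{s,t}=\mathbf{Y}^{\mathbb{1}}_{s,t}-\sum_{a}\mathbf{Y}^{\bullet_a}_s\mathbf{X}^{\bullet_a}_{s,t}-\sum_{a,b}\mathbf{Y}^{\bullet_a\bullet_b}_s\mathbf{X}^{\bullet_a\bullet_b}_{s,t}-\sum_{a,b}\mathbf{Y}^{[\bullet_b]_a}_s\mathbf{X}^{[\bullet_b]_a}_{s,t},$$ $$R\mathbf{Y}^{\bullet_a}_{s,t}=\mathbf{Y}^{\bullet_a}_{s,t}-\sum_b(\mathbf{Y}^{\bullet_b\bullet_a}_s+\mathbf{Y}^{[\bullet_b]_a}_s)\mathbf{X}^{\bullet_b}_{s,t},\quad R\mathbf{Y}^{\bullet_a\bullet_b}_{s,t}=\mathbf{Y}^{\bullet_a\bullet_b}_{s,t},\quad R\mathbf{Y}^{[\bullet_b]_a}_{s,t}=\mathbf{Y}^{[\bullet_b]_a}_{s,t}.$$ With $\|R\mathbf{Y}^\tau\|_{(3-|\tau|)\alpha}:=\sup_{s\neq t}|R\mathbf{Y}^\tau_{s,t}|/|t-s|^{(3-|\tau|)\alpha}$, $\mathbf{Y}$ is an $\mathbf{X}$-controlled planarly branched rough path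 if these are finite for all $\tau\in\mathcal{F}^{\le2}$, and $|||\mathbf{Y}|||_{\mathbf{X};\alpha}:=\sum_{\tau\in\mathcal{F}^{\le2}}\|R\mathbf{Y}^\tau\|_{(3-|\tau|)\alpha}$. $C_b^3(\mathbb{R}^n;\mathbb{R}^n)$ is the space of three times continuously differentiable maps $F$ with $\|F\|_{C_b^3}=\sum_{k=0}^3\sup_x|F^{(k)}(x)|<\infty$; $F',F''$ denote Fréchet derivatives. *)

theory Defs
  imports "HOL-Analysis.Analysis" "HOL-Library.Multiset" "HOL-Library.Sublist"
begin

section \<open>Planar forests\<close>

datatype 'a ptree = Node (root: 'a) (children: "'a ptree list")

type_synonym 'a forest = "'a ptree list"

abbreviation bullet :: "'a \<Rightarrow> 'a ptree" where
  "bullet a \<equiv> Node a []"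

primrec tree_order :: "'a ptree \<Rightarrow> nat" where
  "tree_order (Node a ts) = Suc (sum_list (map tree_order ts))"

definition forest_order :: "'a forest \<Rightarrow> nat" where
  "forest_order \<omega> = sum_list (map tree_order \<omega>)"

definition forests_upto :: "nat \<Rightarrow> 'a forest set" where
  "forests_upto k = {\<tau>. forest_order \<tau> \<le> k}"

lemma tree_order_pos: "0 < tree_order t"
  by (cases t) simp

lemma finite_forests_upto: "finite (forests_upto k :: 'a::finite forest set)"
proof (induction k)
  case 0
  have "\<tau> = []" if "forest_order \<tau> \<le> 0" for \<tau> :: "'a forest"
    using that tree_order_pos[of "hd \<tau>"] by (cases \<tau>) (auto simp: forest_order_def)
  then have "forests_upto 0 \<subseteq> {[] :: 'a forest}"
    by (auto simp: forests_upto_def)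
  then show ?case by (rule finite_subset) simp
next
  case (Suc k)
  have "forests_upto (Suc k) \<subseteq> insert [] ((\<lambda>(a, ts, us). Node a ts # us) `
          (UNIV \<times> forests_upto k \<times> (forests_upto k :: 'a forest set)))"
  proof
    fix \<tau> :: "'a forest"
    assume \<tau>: "\<tau> \<in> forests_upto (Suc k)"
    show "\<tau> \<in> insert [] ((\<lambda>(a, ts, us). Node a ts # us) `
            (UNIV \<times> forests_upto k \<times> forests_upto k))"
    proof (cases \<tau>)
      case (Cons t us)
      obtain a ts where t: "t = Node a ts" by (cases t)
      have "ts \<in> forests_upto k" "us \<in> forests_upto k"
        using \<tau> by (auto simp: Cons t forests_upto_def forest_order_def)
      then show ?thesis
        by (auto simp: Cons t intro!: image_eqI[where x = "(a, ts, us)"])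
    qed simp
  qed
  then show ?case
    by (rule finite_subset) (use Suc in simp)
qed


section \<open>Shuffle product and coproduct\<close>

text \<open>
  Shuffles and coproducts of forests are linear combinations of forests (or pairs of forests) with
  nonnegative integer coefficients; they are represented by multisets, multiplicity being the
  coefficient. (The library function \<open>shuffles\<close> yields a set and forgets multiplicities.)
\<close>

fun shuffle :: "'b list \<Rightarrow> 'b list \<Rightarrow> 'b list multiset" where
  "shuffle [] ys = {#ys#}"
| "shuffle xs [] = {#xs#}"
| "shuffle (x # xs) (y # ys) =
     image_mset ((#) x) (shuffle xs (y # ys)) + image_mset ((#) y) (shuffle (x # xs) ys)"

definition shuffle_all :: "'b list list \<Rightarrow> 'b list multiset" where
  "shuffle_all ws = foldr (\<lambda>w M. \<Sum>u\<in>#M. shuffle w u) ws {#[]#}"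

text \<open>
  A vertex is addressed by the sequence of child indices (from left to right, starting at 0) leading
  to it from the root. An edge is addressed by its endpoint farther from the root, so that the edges
  on the path from the root to \<open>l\<close> are the nonempty prefixes of \<open>l\<close>.
\<close>

primrec vertices :: "'a ptree \<Rightarrow> nat list list" where
  "vertices (Node a ts) =
     [] # concat (map (\<lambda>(i, vs). map ((#) i) vs) (zip [0..<length ts] (map vertices ts)))"

primrec subtree :: "'a ptree \<Rightarrow> nat list \<Rightarrow> 'a ptree" where
  "subtree t [] = t"
| "subtree t (i # p) = subtree (children t ! i) p"

definition edges :: "'a ptree \<Rightarrow> nat list set" where
  "edges t = set (vertices t) - {[]}"

definition leaves :: "'a ptree \<Rightarrow> nat list set" where
  "leaves t = {p \<in> set (vertices t). children (subtree t p) = []}"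

definition left_admissible_cuts :: "'a ptree \<Rightarrow> nat list set set" where
  "left_admissible_cuts t = {c \<in> Pow (edges t).
     (\<forall>p i j. p @ [i] \<in> c \<and> j < i \<longrightarrow> p @ [j] \<in> c) \<and>
     (\<forall>l\<in>leaves t. \<forall>e\<in>c. \<forall>e'\<in>c. prefix e l \<and> prefix e' l \<longrightarrow> e = e')}"

text \<open>\<open>trunk_at c p t\<close> prunes \<open>t\<close>, regarded as the subtree at address \<open>p\<close> of the tree being cut.\<close>

function trunk_at :: "nat list set \<Rightarrow> nat list \<Rightarrow> 'a ptree \<Rightarrow> 'a ptree" where
  "trunk_at c p (Node a ts) =
     Node a (map (\<lambda>i. trunk_at c (p @ [i]) (ts ! i)) (filter (\<lambda>i. p @ [i] \<notin> c) [0..<length ts]))"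
  by pat_completeness auto
termination
  by (relation "Wellfounded.measure (\<lambda>(c, p, t). size t)") (auto simp: less_Suc_eq_le intro!: size_list_estimation'[OF nth_mem])

definition trunk :: "nat list set \<Rightarrow> 'a ptree \<Rightarrow> 'a ptree" where
  "trunk c t = trunk_at c [] t"

definition cut_off_at :: "nat list set \<Rightarrow> 'a ptree \<Rightarrow> nat list \<Rightarrow> 'a forest" where
  "cut_off_at c t p = map (\<lambda>i. subtree t (p @ [i]))
     (filter (\<lambda>i. p @ [i] \<in> c) [0..<length (children (subtree t p))])"

definition pruned :: "nat list set \<Rightarrow> 'a ptree \<Rightarrow> 'a forest multiset" where
  "pruned c t = shuffle_all (map (cut_off_at c t) (vertices t))"

definition tree_coproduct :: "'a ptree \<Rightarrow> ('a forest \<times> 'a forest) multiset" where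
  "tree_coproduct t = {#([t], [])#} +
     (\<Sum>c\<in>left_admissible_cuts t. image_mset (\<lambda>\<omega>. (\<omega>, [trunk c t])) (pruned c t))"

text \<open>The undecorated root is decorated by \<open>None\<close>, all other vertices by \<open>Some\<close>.\<close>

definition B_plus :: "'a forest \<Rightarrow> 'a option ptree" where
  "B_plus \<omega> = Node None (map (map_ptree Some) \<omega>)"

definition forget_option :: "'a option forest \<Rightarrow> 'a forest" where
  "forget_option \<omega> = map (map_ptree the) \<omega>"

definition B_minus :: "'a option forest \<Rightarrow> 'a forest" where
  "B_minus \<omega> = forget_option (children (hd \<omega>))"

definition coproduct :: "'a forest \<Rightarrow> ('a forest \<times> 'a forest) multiset" where
  "coproduct \<omega> = image_mset (\<lambda>(\<sigma>, \<rho>). (forget_option \<sigma>, B_minus \<rho>))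
     (tree_coproduct (B_plus \<omega>) - {#([B_plus \<omega>], [])#})"

text \<open>
  Elements of the dual of the span of the forests of order at most 3 are given by their values on
  forests; only values on forests of order at most 3 are ever used.
\<close>

definition star :: "('a forest \<Rightarrow> real) \<Rightarrow> ('a forest \<Rightarrow> real) \<Rightarrow> 'a forest \<Rightarrow> real" where
  "star x y \<tau> = (\<Sum>(\<sigma>, \<rho>)\<in>#coproduct \<tau>. x \<sigma> * y \<rho>)"


section \<open>Rough paths and controlled paths\<close>

definition holder_quotients :: "real \<Rightarrow> real \<Rightarrow> (real \<Rightarrow> real \<Rightarrow> 'b::real_normed_vector) \<Rightarrow> real set" where
  "holder_quotients T \<gamma> R =
     {norm (R s t) / \<bar>t - s\<bar> powr \<gamma> | s t. s \<in> {0..T} \<and> t \<in> {0..T} \<and> s \<noteq> t}"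

definition holder_finite :: "real \<Rightarrow> real \<Rightarrow> (real \<Rightarrow> real \<Rightarrow> 'b::real_normed_vector) \<Rightarrow> bool" where
  "holder_finite T \<gamma> R \<longleftrightarrow> bdd_above (holder_quotients T \<gamma> R)"

definition holder_norm :: "real \<Rightarrow> real \<Rightarrow> (real \<Rightarrow> real \<Rightarrow> 'b::real_normed_vector) \<Rightarrow> real" where
  "holder_norm T \<gamma> R = Sup (holder_quotients T \<gamma> R)"

type_synonym 'a rough_path = "real \<Rightarrow> real \<Rightarrow> 'a forest \<Rightarrow> real"

definition PBRP :: "real \<Rightarrow> real \<Rightarrow> 'a rough_path set" where
  "PBRP \<alpha> T = {X.
     (\<forall>s\<in>{0..T}. \<forall>t\<in>{0..T}. \<forall>u\<in>{0..T}. \<forall>\<tau>\<in>forests_upto 3. star (X s u) (X u t) \<tau> = X s t \<tau>) \<and>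
     (\<forall>s\<in>{0..T}. \<forall>t\<in>{0..T}. X s t [] = 1) \<and>
     (\<forall>s\<in>{0..T}. \<forall>t\<in>{0..T}. \<forall>\<sigma> \<tau>. forest_order \<sigma> + forest_order \<tau> \<le> 3 \<longrightarrow>
        (\<Sum>\<rho>\<in>#shuffle \<sigma> \<tau>. X s t \<rho>) = X s t \<sigma> * X s t \<tau>) \<and>
     (\<forall>\<tau>\<in>forests_upto 3. holder_finite T (real (forest_order \<tau>) * \<alpha>) (\<lambda>s t. X s t \<tau>))}"

definition rp_norm :: "real \<Rightarrow> real \<Rightarrow> 'a::finite rough_path \<Rightarrow> real" where
  "rp_norm \<alpha> T X =
     (\<Sum>\<tau>\<in>forests_upto 3 - {[]}. holder_norm T (real (forest_order \<tau>) * \<alpha>) (\<lambda>s t. X s t \<tau>))"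

text \<open>
  A path in the \<open>n\<close>-fold power of the span of the forests of order at most 2 is given by its
  coefficients; those at forests of higher order are never used.
\<close>

type_synonym ('a, 'n) controlled_path = "real \<Rightarrow> 'a forest \<Rightarrow> real ^ 'n"

fun remainder :: "'a::finite rough_path \<Rightarrow> ('a, 'n::finite) controlled_path \<Rightarrow> 'a forest \<Rightarrow>
    real \<Rightarrow> real \<Rightarrow> real ^ 'n" where
  "remainder X Y [] s t = Y t [] - Y s []
     - (\<Sum>a\<in>UNIV. X s t [bullet a] *\<^sub>R Y s [bullet a])
     - (\<Sum>a\<in>UNIV. \<Sum>b\<in>UNIV. X s t [bullet a, bullet b] *\<^sub>R Y s [bullet a, bullet b])
     - (\<Sum>a\<in>UNIV. \<Sum>b\<in>UNIV. X s t [Node a [bullet b]] *\<^sub>R Y s [Node a [bullet b]])"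
| "remainder X Y [bullet a] s t = Y t [bullet a] - Y s [bullet a]
     - (\<Sum>b\<in>UNIV. X s t [bullet b] *\<^sub>R (Y s [bullet b, bullet a] + Y s [Node a [bullet b]]))"
| "remainder X Y \<tau> s t = Y t \<tau> - Y s \<tau>"

definition controlled :: "real \<Rightarrow> real \<Rightarrow> 'a::finite rough_path \<Rightarrow> ('a, 'n::finite) controlled_path set" where
  "controlled \<alpha> T X =
     {Y. \<forall>\<tau>\<in>forests_upto 2. holder_finite T ((3 - real (forest_order \<tau>)) * \<alpha>) (remainder X Y \<tau>)}"

definition controlled_norm :: "real \<Rightarrow> real \<Rightarrow> 'a::finite rough_path \<Rightarrow> ('a, 'n::finite) controlled_path \<Rightarrow> real" where
  "controlled_norm \<alpha> T X Y =
     (\<Sum>\<tau>\<in>forests_upto 2. holder_norm T ((3 - real (forest_order \<tau>)) * \<alpha>) (remainder X Y \<tau>))"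


section \<open>Smooth functions of controlled paths\<close>

definition fderiv :: "('b::real_normed_vector \<Rightarrow> 'c::real_normed_vector) \<Rightarrow> 'b \<Rightarrow> 'b \<Rightarrow>\<^sub>L 'c" where
  "fderiv f x = Blinfun (frechet_derivative f (at x))"

definition Cb3 :: "('b::real_normed_vector \<Rightarrow> 'c::real_normed_vector) set" where
  "Cb3 = {F.
     (\<forall>x. F differentiable (at x)) \<and>
     (\<forall>x. fderiv F differentiable (at x)) \<and>
     (\<forall>x. fderiv (fderiv F) differentiable (at x)) \<and>
     continuous_on UNIV (fderiv (fderiv (fderiv F))) \<and>
     bounded (range F) \<and> bounded (range (fderiv F)) \<and>
     bounded (range (fderiv (fderiv F))) \<and> bounded (range (fderiv (fderiv (fderiv F))))}"

definition Cb3_norm :: "('b::real_normed_vector \<Rightarrow> 'c::real_normed_vector) \<Rightarrow> real" where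
  "Cb3_norm F = (SUP x. norm (F x)) + (SUP x. norm (fderiv F x)) +
     (SUP x. norm (fderiv (fderiv F) x)) + (SUP x. norm (fderiv (fderiv (fderiv F)) x))"

fun compose_controlled :: "(real ^ 'n \<Rightarrow> real ^ 'n) \<Rightarrow> ('a, 'n::finite) controlled_path \<Rightarrow>
    ('a, 'n) controlled_path" where
  "compose_controlled F Y t [] = F (Y t [])"
| "compose_controlled F Y t [bullet a] = fderiv F (Y t []) (Y t [bullet a])"
| "compose_controlled F Y t [Node a [bullet b]] = fderiv F (Y t []) (Y t [Node a [bullet b]])"
| "compose_controlled F Y t [bullet a, bullet b] =
     fderiv F (Y t []) (Y t [bullet a, bullet b]) +
     fderiv (fderiv F) (Y t []) (Y t [bullet a]) (Y t [bullet b])"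
| "compose_controlled F Y t _ = 0"

definition increasing_in_each :: "(real \<Rightarrow> real \<Rightarrow> real \<Rightarrow> real \<Rightarrow> real \<Rightarrow> real \<Rightarrow> real) \<Rightarrow> bool" where
  "increasing_in_each M \<longleftrightarrow> (\<forall>u\<ge>0. \<forall>v\<ge>0. \<forall>w\<ge>0. \<forall>x\<ge>0. \<forall>y\<ge>0.
     strict_mono_on {0..} (\<lambda>r. M r u v w x y) \<and>
     strict_mono_on {0..} (\<lambda>r. M u r v w x y) \<and>
     strict_mono_on {0..} (\<lambda>r. M u v r w x y) \<and>
     strict_mono_on {0..} (\<lambda>r. M u v w r x y) \<and>
     strict_mono_on {0..} (\<lambda>r. M u v w x r y) \<and>
     strict_mono_on {0..} (\<lambda>r. M u v w x y r))"

end

(* Expand F at Y_s to second order. With q the first-order part (sum over a of X^a Y_s^a) of the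
   increment of Y, the increment is q plus a term of order 2 alpha, and the shuffle relation
   X^a X^b = X^{ab} + X^{ba} together with the symmetry of F'' turns F''(q, q)/2 into
   the sum of X^{ab} F''(Y^a, Y^b), the correction in the coefficients of F(Y). What is left are
   Taylor remainders and remainders of Y. All coefficients of Y on [0, T] are
   bounded polynomially in S = 1 + (sum of the arguments of M), so a multiple of a power of S
   serves as M. *)

theory Submission
  imports Defs
begin

text \<open>The value \<open>Y 0 []\<close> is not among the arguments of M, so the path may start
  anywhere; the estimates therefore use only increments of \<open>Y t []\<close> and suprema of the
  derivatives of F over the whole space. Taylor errors come from the mean value inequality instead
  of integral remainders, so they carry B where B/2 or B/6 would be sharp; M absorbs such factors. A
  term of a remainder is a product of coefficients, Hoelder constants and powers of u = |t -
  s|^alpha. Where the power of u is higher than needed, surplus factors u are bounded through u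
  \<le> 1 + T. To keep this uniform, one number P dominates all these factors, increments of Y are
  bounded with a constant L of order P^3, and no remainder of F(Y) needs more than three factors L.
  Coefficients of Y are at most of order S^4, which gives the power 4 * 3 * 3 = 36 of S.\<close>

subsection \<open>Taylor expansion with Lipschitz derivatives\<close>

lemma has_derivative_fderiv:
  assumes "f differentiable (at x)"
  shows "(f has_derivative blinfun_apply (fderiv f x)) (at x)"
  using assms
  by (simp add: fderiv_def frechet_derivative_works bounded_linear_Blinfun_apply has_derivative_bounded_linear)

text \<open>Mean value inequality on a convex set. The bound is asked for only on a ball around
  \<open>y\<close>, so \<open>C\<close> may depend on the distance of \<open>x\<close> and
  \<open>y\<close>; this is how the errors below gain an order.\<close>

lemma blinfun_derivative_bound:
  fixes f :: "'b::real_normed_vector \<Rightarrow> 'c::real_normed_vector"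
  assumes "\<And>x. (f has_derivative blinfun_apply (f' x)) (at x)"
    and "\<And>x. x \<in> cball y r \<Longrightarrow> norm (f' x) \<le> C"
    and "norm (x - y) \<le> r"
  shows "norm (f x - f y) \<le> C * norm (x - y)"
proof (rule differentiable_bound[where S = "cball y r" and f' = "\<lambda>x. blinfun_apply (f' x)"])
  show "x \<in> cball y r" "y \<in> cball y r"
    using assms(3) norm_ge_zero[of "x - y"] by (auto simp: dist_norm norm_minus_commute simp del: norm_ge_zero)
qed (use assms(1,2) in \<open>auto simp: has_derivative_at_withinI simp flip: norm_blinfun.rep_eq\<close>)

text \<open>Removing the linear part at \<open>y\<close> leaves a function with derivative
  \<open>f' z - f' y\<close>, which is at most \<open>B * norm (x - y)\<close> on the ball; the mean
  value inequality supplies the second factor.\<close>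

lemma linearization_error:
  fixes f :: "'b::real_normed_vector \<Rightarrow> 'c::real_normed_vector"
  assumes f': "\<And>x. (f has_derivative blinfun_apply (f' x)) (at x)"
    and lip: "\<And>x y. norm (f' x - f' y) \<le> B * norm (x - y)" and "0 \<le> B"
  shows "norm (f x - f y - f' y (x - y)) \<le> B * (norm (x - y))\<^sup>2"
proof -
  let ?g = "\<lambda>z. f z - f' y (z - y)"
  have "norm (?g x - ?g y) \<le> (B * norm (x - y)) * norm (x - y)"
  proof (rule blinfun_derivative_bound)
    show "(?g has_derivative blinfun_apply (f' z - f' y)) (at z)" for z
      by (auto intro!: derivative_eq_intros f' simp: blinfun.bilinear_simps)
    show "norm (f' z - f' y) \<le> B * norm (x - y)" if "z \<in> cball y (norm (x - y))" for z
      using that lip[of z y] \<open>0 \<le> B\<close>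
      by (auto simp: dist_norm norm_minus_commute intro: order_trans mult_left_mono)
  qed simp
  then show ?thesis
    by (simp add: blinfun.bilinear_simps power2_eq_square algebra_simps)
qed

lemma second_derivative_symmetric:
  fixes f :: "'b::real_normed_vector \<Rightarrow> 'c::real_normed_vector"
  assumes f': "\<And>x. (f has_derivative blinfun_apply (f' x)) (at x)"
    and f'': "\<And>x. (f' has_derivative blinfun_apply (f'' x)) (at x)"
    and lip: "\<And>x y. norm (f'' x - f'' y) \<le> B * norm (x - y)" and B: "0 \<le> B"
  shows "f'' x u v = f'' x v u"
proof -
  \<comment> \<open>The second difference is symmetric in \<open>u\<close>, \<open>v\<close> and agrees with \<open>f'' x v u\<close> up to third order.\<close>
  let ?\<Delta> = "\<lambda>u v. f (x + u + v) - f (x + u) - f (x + v) + f x"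
  have err: "norm (?\<Delta> u v - f'' x v u) \<le> 2 * B * (norm u + norm v)^3" for u v
  proof -
    \<comment> \<open>Its increment from \<open>x\<close> to \<open>x + u\<close> is the quantity to
      be bounded, and its derivative is a difference of \<open>f'\<close> in the direction
      \<open>v\<close> minus the linear prediction.\<close>
    let ?g = "\<lambda>w. f (w + v) - f w - f'' x v w"
    have "norm (?g (x + u) - ?g x) \<le> (2 * B * (norm u + norm v)\<^sup>2) * norm (x + u - x)"
    proof (rule blinfun_derivative_bound)
      show "(?g has_derivative blinfun_apply (f' (w + v) - f' w - f'' x v)) (at w)" for w
        by (auto intro!: derivative_eq_intros has_derivative_compose[OF _ f'] f' simp: blinfun.bilinear_simps)
      show "norm (f' (w + v) - f' w - f'' x v) \<le> 2 * B * (norm u + norm v)\<^sup>2"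
        if "w \<in> cball x (norm u)" for w
      proof -
        have w: "norm (w - x) \<le> norm u"
          using that by (simp add: dist_norm norm_minus_commute)
        have "norm (w + v - x) \<le> norm (w - x) + norm v"
          by (metis add_diff_eq add.commute norm_triangle_ineq)
        then have "norm (w + v - x) \<le> norm u + norm v" "norm (w - x) \<le> norm u + norm v"
          using w by (auto intro: order_trans)
        then have "B * (norm (w + v - x))\<^sup>2 \<le> B * (norm u + norm v)\<^sup>2"
            "B * (norm (w - x))\<^sup>2 \<le> B * (norm u + norm v)\<^sup>2"
          using B by (auto intro!: mult_left_mono power_mono)
        \<comment> \<open>Both values of \<open>f'\<close> are linearized at the same point
          \<open>x\<close>, so the two errors have the same form.\<close>
        moreover have "f' (w + v) - f' w - f'' x v =
            (f' (w + v) - f' x - f'' x (w + v - x)) - (f' w - f' x - f'' x (w - x))"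
          by (simp add: blinfun.bilinear_simps)
        ultimately show ?thesis
          using linearization_error[OF f'' lip B, of "w + v" x] linearization_error[OF f'' lip B, of w x]
            norm_triangle_ineq4[of "f' (w + v) - f' x - f'' x (w + v - x)" "f' w - f' x - f'' x (w - x)"]
          by (simp add: algebra_simps)
      qed
    qed simp
    also have "\<dots> \<le> (2 * B * (norm u + norm v)\<^sup>2) * (norm u + norm v)"
      using B by (intro mult_left_mono) auto
    finally show ?thesis
      by (simp add: blinfun.bilinear_simps power3_eq_cube power2_eq_square algebra_simps)
  qed
  let ?E = "norm (f'' x u v - f'' x v u)" and ?K = "4 * B * (norm u + norm v)^3"
  \<comment> \<open>Scaling both directions by \<open>t\<close> multiplies the antisymmetric part by
    t^2 and the error by t^3; after division a multiple of \<open>t\<close> remains, which tends to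
    0.\<close>
  have "?E \<le> ?K * t" if "0 < t" for t
  proof -
    have "norm (f'' x (t *\<^sub>R u) (t *\<^sub>R v) - f'' x (t *\<^sub>R v) (t *\<^sub>R u)) \<le>
        2 * (2 * B * (norm (t *\<^sub>R u) + norm (t *\<^sub>R v))^3)"
      using err[of "t *\<^sub>R u" "t *\<^sub>R v"] err[of "t *\<^sub>R v" "t *\<^sub>R u"]
        norm_triangle_ineq4[of "?\<Delta> (t *\<^sub>R u) (t *\<^sub>R v) - f'' x (t *\<^sub>R v) (t *\<^sub>R u)"
          "?\<Delta> (t *\<^sub>R v) (t *\<^sub>R u) - f'' x (t *\<^sub>R u) (t *\<^sub>R v)"]
      by (simp add: algebra_simps)
    moreover have "f'' x (t *\<^sub>R u) (t *\<^sub>R v) - f'' x (t *\<^sub>R v) (t *\<^sub>R u) = t\<^sup>2 *\<^sub>R (f'' x u v - f'' x v u)"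
      by (simp add: blinfun.bilinear_simps power2_eq_square scaleR_diff_right)
    moreover have "norm (t *\<^sub>R u) + norm (t *\<^sub>R v) = t * (norm u + norm v)"
      using that by (simp add: algebra_simps)
    ultimately have "t\<^sup>2 * ?E \<le> 2 * (2 * B * (t * (norm u + norm v))^3)"
      by simp
    also have "\<dots> = t\<^sup>2 * (?K * t)"
      by (simp only: power_mult_distrib) (simp add: power2_eq_square power3_eq_cube)
    finally show ?thesis
      using that by simp
  qed
  moreover have "((\<lambda>t. ?K * t) \<longlongrightarrow> ?K * 0) (at_right 0)"
    by (intro tendsto_intros)
  ultimately have "?E \<le> ?K * 0"
    by (intro tendsto_lowerbound[where F = "at_right 0"]) (auto simp: eventually_at_right_less intro: eventually_mono[OF eventually_at_right_less])
  then show ?thesis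
    by simp
qed

text \<open>The derivative of the error is the linearization error of \<open>f'\<close>, so the mean
  value inequality raises the order from 2 to 3. Symmetry of \<open>f''\<close> is what identifies
  this derivative: the product rule yields the average of \<open>f'' y (z - y) h\<close> and
  \<open>f'' y h (z - y)\<close>.\<close>

lemma quadratic_taylor_error:
  fixes f :: "'b::real_normed_vector \<Rightarrow> 'c::real_normed_vector"
  assumes f': "\<And>x. (f has_derivative blinfun_apply (f' x)) (at x)"
    and f'': "\<And>x. (f' has_derivative blinfun_apply (f'' x)) (at x)"
    and lip: "\<And>x y. norm (f'' x - f'' y) \<le> B * norm (x - y)" and B: "0 \<le> B"
  shows "norm (f x - f y - f' y (x - y) - (1/2) *\<^sub>R f'' y (x - y) (x - y)) \<le> B * norm (x - y) ^ 3"
proof -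
  let ?g = "\<lambda>z. f z - f' y (z - y) - (1/2) *\<^sub>R f'' y (z - y) (z - y)"
  have "norm (?g x - ?g y) \<le> (B * (norm (x - y))\<^sup>2) * norm (x - y)"
  proof (rule blinfun_derivative_bound)
    have sym: "f'' y u v = f'' y v u" for u v
      by (rule second_derivative_symmetric[OF f' f'' lip B])
    have half: "(1/2) *\<^sub>R (w + w) = w" for w :: 'c
      by (simp flip: scaleR_2)
    show "(?g has_derivative blinfun_apply (f' z - f' y - f'' y (z - y))) (at z)" for z
    proof (rule has_derivative_eq_rhs)
      show "(?g has_derivative (\<lambda>h. f' z h - f' y h - (1/2) *\<^sub>R (f'' y (z - y) h + f'' y h (z - y)))) (at z)"
        by (auto intro!: derivative_eq_intros f' simp: blinfun.bilinear_simps)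
      show "(\<lambda>h. f' z h - f' y h - (1/2) *\<^sub>R (f'' y (z - y) h + f'' y h (z - y))) =
          blinfun_apply (f' z - f' y - f'' y (z - y))"
        unfolding sym[of _ "z - y"] half by (rule ext) (simp only: blinfun.diff_left)
    qed
    show "norm (f' z - f' y - f'' y (z - y)) \<le> B * (norm (x - y))\<^sup>2" if "z \<in> cball y (norm (x - y))" for z
      using that B by (intro order_trans[OF linearization_error[OF f'' lip B]] mult_left_mono power_mono)
        (auto simp: dist_norm norm_minus_commute)
  qed simp
  then show ?thesis
    by (simp add: blinfun.bilinear_simps power2_eq_square power3_eq_cube algebra_simps)
qed

section \<open>Bounds and Lipschitz constants from the norm of C_b^3\<close>

lemma Cb3_derivatives:
  assumes "F \<in> Cb3"
  shows "(F has_derivative blinfun_apply (fderiv F x)) (at x)"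
    and "(fderiv F has_derivative blinfun_apply (fderiv (fderiv F) x)) (at x)"
    and "(fderiv (fderiv F) has_derivative blinfun_apply (fderiv (fderiv (fderiv F)) x)) (at x)"
  using assms by (auto simp: Cb3_def intro: has_derivative_fderiv)

lemma norm_le_SUP:
  assumes "bounded (range f)"
  shows "norm (f x) \<le> (SUP x. norm (f x))"
  using assms by (intro cSUP_upper) (auto simp: bounded_iff bdd_above_def)

lemma Cb3_norm_bounds:
  assumes "F \<in> Cb3"
  shows "norm (fderiv F x) \<le> Cb3_norm F"
    and "norm (fderiv (fderiv F) x) \<le> Cb3_norm F"
    and "norm (fderiv (fderiv (fderiv F)) x) \<le> Cb3_norm F"
    and "0 \<le> Cb3_norm F"
proof -
  have "norm (F x) \<le> (SUP x. norm (F x))" "norm (fderiv F x) \<le> (SUP x. norm (fderiv F x))"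
    "norm (fderiv (fderiv F) x) \<le> (SUP x. norm (fderiv (fderiv F) x))"
    "norm (fderiv (fderiv (fderiv F)) x) \<le> (SUP x. norm (fderiv (fderiv (fderiv F)) x))"
    using assms by (auto simp: Cb3_def intro!: norm_le_SUP)
  moreover have "0 \<le> norm (F x)" "0 \<le> norm (fderiv F x)" "0 \<le> norm (fderiv (fderiv F) x)"
    "0 \<le> norm (fderiv (fderiv (fderiv F)) x)" by auto
  ultimately show "norm (fderiv F x) \<le> Cb3_norm F"
    "norm (fderiv (fderiv F) x) \<le> Cb3_norm F"
    "norm (fderiv (fderiv (fderiv F)) x) \<le> Cb3_norm F"
    "0 \<le> Cb3_norm F"
    unfolding Cb3_norm_def by linarith+
qed

text \<open>This is the form in which the bound on the third derivative enters the Taylor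
  errors.\<close>

lemma Cb3_lipschitz:
  assumes "F \<in> Cb3"
  shows "norm (fderiv F x - fderiv F y) \<le> Cb3_norm F * norm (x - y)"
    and "norm (fderiv (fderiv F) x - fderiv (fderiv F) y) \<le> Cb3_norm F * norm (x - y)"
  using blinfun_derivative_bound[OF Cb3_derivatives(2)[OF assms] Cb3_norm_bounds(2)[OF assms] order_refl]
    blinfun_derivative_bound[OF Cb3_derivatives(3)[OF assms] Cb3_norm_bounds(3)[OF assms] order_refl]
  by auto

subsection \<open>Hoelder seminorms\<close>

text \<open>As \<open>0 < T\<close>, the two end points give a quotient. This rules out a supremum
  over the empty set and makes the seminorms nonnegative.\<close>

lemma holder_quotients_nonneg:
  assumes "0 < T"
  shows "\<exists>q\<in>holder_quotients T \<gamma> R. 0 \<le> q"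
proof
  show "norm (R 0 T) / \<bar>T - 0\<bar> powr \<gamma> \<in> holder_quotients T \<gamma> R"
    unfolding holder_quotients_def mem_Collect_eq
    by (rule exI[of _ 0], rule exI[of _ T]) (use assms in auto)
qed simp

lemma holder_norm_nonneg:
  assumes "0 < T" "holder_finite T \<gamma> R"
  shows "0 \<le> holder_norm T \<gamma> R"
  using holder_quotients_nonneg[OF assms(1), of \<gamma> R] assms(2)
  unfolding holder_norm_def holder_finite_def by (meson cSup_upper order_trans)

lemma holder_norm_bound:
  assumes "holder_finite T \<gamma> R" "s \<in> {0..T}" "t \<in> {0..T}" "s \<noteq> t"
  shows "norm (R s t) \<le> holder_norm T \<gamma> R * \<bar>t - s\<bar> powr \<gamma>"
proof -
  have "norm (R s t) / \<bar>t - s\<bar> powr \<gamma> \<le> holder_norm T \<gamma> R"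
    using assms unfolding holder_norm_def holder_finite_def
    by (intro cSup_upper) (auto simp: holder_quotients_def)
  then show ?thesis
    using assms(4) by (simp add: pos_divide_le_eq)
qed

lemma holder_normI:
  assumes "0 < T"
    and "\<And>s t. s \<in> {0..T} \<Longrightarrow> t \<in> {0..T} \<Longrightarrow> s \<noteq> t \<Longrightarrow> norm (R s t) \<le> K * \<bar>t - s\<bar> powr \<gamma>"
  shows "holder_finite T \<gamma> R" and "holder_norm T \<gamma> R \<le> K"
proof -
  have *: "q \<le> K" if "q \<in> holder_quotients T \<gamma> R" for q
    using that assms(2) by (auto simp: holder_quotients_def pos_divide_le_eq)
  then show "holder_finite T \<gamma> R"
    by (auto simp: holder_finite_def bdd_above_def)
  show "holder_norm T \<gamma> R \<le> K"
    unfolding holder_norm_def using * holder_quotients_nonneg[OF assms(1)] by (intro cSup_least) auto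
qed

text \<open>Without the root of its first tree, the forest has at most one vertex left, either below
  that root or to its right.\<close>

lemma forests_upto_2_cases:
  assumes "\<tau> \<in> forests_upto 2"
  obtains "\<tau> = []" | a where "\<tau> = [bullet a]" | a b where "\<tau> = [bullet a, bullet b]"
    | a b where "\<tau> = [Node a [bullet b]]"
proof -
  have zero: "forest_order \<sigma> = 0 \<Longrightarrow> \<sigma> = []" for \<sigma> :: "'a forest"
    using tree_order_pos[of "hd \<sigma>"] by (cases \<sigma>) (auto simp: forest_order_def)
  have one: "\<exists>b. \<sigma> = [bullet b]" if "forest_order \<sigma> = 1" for \<sigma> :: "'a forest"
  proof (cases \<sigma>)
    case (Cons t us)
    then show ?thesis
      using that zero zero[of "children t"] by (cases t) (auto simp: forest_order_def)
  qed (use that in \<open>auto simp: forest_order_def\<close>)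
  show ?thesis
  proof (cases \<tau>)
    case (Cons t us)
    obtain a ts where t: "t = Node a ts" by (cases t)
    have "forest_order ts + forest_order us \<le> 1"
      using assms by (auto simp: Cons t forests_upto_def forest_order_def)
    then consider "forest_order ts = 0" "forest_order us = 0" | "forest_order ts = 1" "forest_order us = 0"
      | "forest_order ts = 0" "forest_order us = 1" by linarith
    then show ?thesis
      using Cons t that zero one by cases blast+
  qed (use that in auto)
qed

subsection \<open>Remainders of the composition over one interval\<close>

lemma one_le_card: "1 \<le> real CARD('a::finite)"
  using zero_less_card_finite[where 'a = 'a] by linarith

lemma norm_sum_UNIV_le:
  fixes f :: "'a::finite \<Rightarrow> 'b::real_normed_vector"
  assumes "\<And>a. norm (f a) \<le> K"
  shows "norm (\<Sum>a\<in>UNIV. f a) \<le> real CARD('a) * K"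
  using sum_norm_bound[of UNIV f K] assms by simp

lemma norm_blinfun_le:
  assumes "norm A \<le> a" "norm x \<le> b" "0 \<le> a"
  shows "norm (blinfun_apply A x) \<le> a * b"
  using order_trans[OF norm_blinfun mult_mono[OF assms(1,2)]] assms(3) by simp

lemma norm_blinfun2_le:
  assumes "norm A \<le> a" "norm x \<le> b" "norm y \<le> c" "0 \<le> a"
  shows "norm (blinfun_apply (blinfun_apply A x) y) \<le> a * b * c"
proof -
  have "0 \<le> b"
    using assms(2) norm_ge_zero order_trans by blast
  then show ?thesis
    using assms by (intro norm_blinfun_le) auto
qed

text \<open>
  In the application \<open>u = \<bar>t - s\<bar> powr \<alpha>\<close>, and \<open>P\<close> bounds \<open>u\<close>, the coefficients of \<open>Y\<close> and all
  Hoelder constants.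
\<close>

locale controlled_increment =
  fixes X :: "'a::finite rough_path" and Y :: "('a, 'n::finite) controlled_path"
    and F :: "real ^ 'n \<Rightarrow> real ^ 'n" and s t u P L :: real
  defines "L \<equiv> 4 * (real CARD('a))\<^sup>2 * P ^ 3"
  assumes F: "F \<in> Cb3" and P: "1 \<le> P" and u: "0 \<le> u" "u \<le> P"
    and X1: "\<bar>X s t [bullet a]\<bar> \<le> P * u"
    and X2: "\<bar>X s t [bullet a, bullet b]\<bar> \<le> P * u\<^sup>2"
    and X3: "\<bar>X s t [Node a [bullet b]]\<bar> \<le> P * u\<^sup>2"
    and shuffle: "X s t [bullet a] * X s t [bullet b] = X s t [bullet a, bullet b] + X s t [bullet b, bullet a]"
    and Y1: "r \<in> {s, t} \<Longrightarrow> norm (Y r [bullet a]) \<le> P"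
    and Y2: "r \<in> {s, t} \<Longrightarrow> norm (Y r [bullet a, bullet b]) \<le> P"
    and Y3: "r \<in> {s, t} \<Longrightarrow> norm (Y r [Node a [bullet b]]) \<le> P"
    and R0: "norm (remainder X Y [] s t) \<le> P * u ^ 3"
    and R1: "norm (remainder X Y [bullet a] s t) \<le> P * u\<^sup>2"
    and R2: "norm (remainder X Y [bullet a, bullet b] s t) \<le> P * u"
    and R3: "norm (remainder X Y [Node a [bullet b]] s t) \<le> P * u"
begin

abbreviation "B \<equiv> Cb3_norm F"
abbreviation "F' \<equiv> fderiv F"
abbreviation "F'' \<equiv> fderiv (fderiv F)"

section \<open>Increments of Y over one interval\<close>

definition q where "q = (\<Sum>a\<in>UNIV. X s t [bullet a] *\<^sub>R Y s [bullet a])"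
definition \<delta> where "\<delta> = Y t [] - Y s []"

lemma P_le_L: "P \<le> L" and L_ge_1: "1 \<le> L"
proof -
  have "1 * P \<le> (real CARD('a))\<^sup>2 * P ^ 3"
    using one_le_card[where 'a = 'a] P by (intro mult_mono self_le_power) (auto simp: one_le_power)
  then show "P \<le> L"
    using P unfolding L_def by linarith
  then show "1 \<le> L"
    using P by linarith
qed

text \<open>Raises terms with one or two factors \<open>L\<close> to the common form
  \<open>B * L ^ 3\<close> times a power of \<open>u\<close>.\<close>

lemma L3: "L * L \<le> L ^ 3" "L \<le> L ^ 3"
  using L_ge_1 power_increasing[of 2 3 L] power_increasing[of 1 3 L] by (auto simp: power2_eq_square)

text \<open>The definitions of the remainders are solved for the increments. All pieces of \<delta>
  other than \<open>q\<close> carry at least u^2, so \<open>\<delta> - q\<close> gains an order.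
  Surplus factors \<open>u\<close> are exchanged for \<open>P\<close>, and double sums over the
  decorations give the square of their number.\<close>

lemma increment_bounds:
  "norm q \<le> L * u" "norm \<delta> \<le> L * u" "norm (\<delta> - q) \<le> L * u\<^sup>2"
  "norm (Y t [bullet a] - Y s [bullet a]) \<le> L * u"
proof -
  let ?D = "real CARD('a)"
  let ?K = "?D\<^sup>2 * P ^ 3"
  define A where "A = (\<Sum>a\<in>UNIV. \<Sum>b\<in>UNIV. X s t [bullet a, bullet b] *\<^sub>R Y s [bullet a, bullet b])"
  define C where "C = (\<Sum>a\<in>UNIV. \<Sum>b\<in>UNIV. X s t [Node a [bullet b]] *\<^sub>R Y s [Node a [bullet b]])"
  define r where "r = remainder X Y [] s t"
  have \<delta>: "\<delta> = q + A + C + r"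
    by (simp add: \<delta>_def q_def A_def C_def r_def)
  have D: "?D \<le> ?D\<^sup>2" "1 \<le> ?D\<^sup>2"
    using one_le_card[where 'a = 'a] by (auto intro: self_le_power one_le_power)
  have P3: "P * P \<le> P ^ 3" "P \<le> P ^ 3"
    using P power_increasing[of 2 3 P] power_increasing[of 1 3 P] by (auto simp: power2_eq_square)
  have "norm q \<le> ?D * (P * u * P)"
    unfolding q_def using X1 Y1 u P by (auto intro!: norm_sum_UNIV_le mult_mono)
  also have "\<dots> = ?D * (P * P) * u"
    by simp
  also have "\<dots> \<le> ?K * u"
    using D P3 P u by (intro mult_mono) auto
  finally have q: "norm q \<le> ?K * u" .
  have DD: "?D * (?D * (P * u\<^sup>2 * P)) \<le> ?K * u\<^sup>2"
  proof -
    have "?D * (?D * (P * u\<^sup>2 * P)) = ?D\<^sup>2 * (P * P) * u\<^sup>2"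
      by (simp add: power2_eq_square)
    also have "\<dots> \<le> ?K * u\<^sup>2"
      using P3 P by (intro mult_mono) auto
    finally show ?thesis .
  qed
  \<comment> \<open>The quantity of \<open>DD\<close> again, with one more \<open>u\<close>
    exchanged for \<open>P\<close>: order two serves \<open>\<delta> - q\<close>, order one serves
    \<delta>. The bounds \<open>r\<close> and \<open>r'\<close> are paired in the same way.\<close>
  have DD': "?D * (?D * (P * u\<^sup>2 * P)) \<le> ?K * u"
  proof -
    have "?D * (?D * (P * u\<^sup>2 * P)) = ?D\<^sup>2 * (P * P * u) * u"
      by (simp add: power2_eq_square)
    also have "\<dots> \<le> ?D\<^sup>2 * (P * P * P) * u"
      using P u by (intro mult_mono) auto
    finally show ?thesis by (simp add: power3_eq_cube)
  qed
  have A: "norm A \<le> ?D * (?D * (P * u\<^sup>2 * P))"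
    unfolding A_def using X2 Y2 u P by (auto intro!: norm_sum_UNIV_le mult_mono)
  have C: "norm C \<le> ?D * (?D * (P * u\<^sup>2 * P))"
    unfolding C_def using X3 Y3 u P by (auto intro!: norm_sum_UNIV_le mult_mono)
  have "P * u ^ 3 = 1 * (P * u) * u\<^sup>2"
    by (simp add: power2_eq_square power3_eq_cube)
  also have "\<dots> \<le> 1 * (P * P) * u\<^sup>2"
    using P u by (intro mult_mono) auto
  also have "\<dots> \<le> ?K * u\<^sup>2"
    using D P3 P u by (intro mult_mono) auto
  finally have r: "norm r \<le> ?K * u\<^sup>2"
    using R0 by (simp add: r_def)
  have "P * u ^ 3 = 1 * (P * u * u) * u"
    by (simp add: power3_eq_cube)
  also have "\<dots> \<le> ?D\<^sup>2 * (P * P * P) * u"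
    using D P u by (intro mult_mono) auto
  finally have r': "norm r \<le> ?K * u"
    using R0 by (simp add: r_def power3_eq_cube)
  \<comment> \<open>The factor 4 counts the pieces \<open>q\<close>, \<open>A\<close>,
    \<open>C\<close> and \<open>r\<close> of \<delta>, each at most \<open>?K * u\<close>.\<close>
  have L: "L = 4 * ?K" unfolding L_def by simp
  have K0: "0 \<le> ?K * u" "0 \<le> ?K * u\<^sup>2"
    using P u by auto
  show "norm q \<le> L * u" using q K0 unfolding L by linarith
  have tri: "norm (w + x + y) \<le> norm w + norm x + norm y" for w x y :: "real^'n"
    by (metis norm_triangle_mono norm_triangle_ineq order_refl)
  have "norm \<delta> \<le> norm q + norm (A + C + r)"
    unfolding \<delta> using norm_triangle_ineq[of q "A + C + r"] by (simp add: add.assoc)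
  then show "norm \<delta> \<le> L * u"
    using q A C r' DD' tri[of A C r] unfolding L by linarith
  have "norm (A + C + r) \<le> L * u\<^sup>2"
    using A C r DD tri[of A C r] K0 unfolding L by linarith
  then show "norm (\<delta> - q) \<le> L * u\<^sup>2"
    by (simp add: \<delta> add.assoc)
  let ?E = "\<Sum>b\<in>UNIV. X s t [bullet b] *\<^sub>R (Y s [bullet b, bullet a] + Y s [Node a [bullet b]])"
  have "norm (Y s [bullet b, bullet a] + Y s [Node a [bullet b]]) \<le> 2 * P" for b
    using norm_triangle_mono[OF Y2[of s b a] Y3[of s a b]] by simp
  then have "norm ?E \<le> ?D * (P * u * (2 * P))"
    using X1 u P by (auto intro!: norm_sum_UNIV_le mult_mono)
  also have "\<dots> = 2 * (?D * (P * P) * u)"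
    by simp
  also have "?D * (P * P) * u \<le> ?K * u"
    using D P3 P u by (intro mult_mono) auto
  finally have E: "norm ?E \<le> 2 * (?K * u)" by simp
  have "P * u\<^sup>2 = 1 * (P * u) * u"
    by (simp add: power2_eq_square)
  also have "\<dots> \<le> 1 * (P * P) * u"
    using P u by (intro mult_mono) auto
  also have "\<dots> \<le> ?K * u"
    using D P3 P u by (intro mult_mono) auto
  finally have "P * u\<^sup>2 \<le> ?K * u" .
  then have "norm (remainder X Y [bullet a] s t) \<le> ?K * u"
    using R1[of a] by linarith
  then have "norm (remainder X Y [bullet a] s t + ?E) \<le> L * u"
    using E K0 norm_triangle_ineq[of "remainder X Y [bullet a] s t" ?E] unfolding L by linarith
  then show "norm (Y t [bullet a] - Y s [bullet a]) \<le> L * u"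
    by simp
qed

lemma fderiv_bounds:
  "0 \<le> B" "norm (F' x) \<le> B" "norm (F'' x) \<le> B"
  "norm (F' (Y t []) - F' (Y s [])) \<le> B * (L * u)"
  "norm (F'' (Y t []) - F'' (Y s [])) \<le> B * (L * u)"
  using Cb3_norm_bounds[OF F] Cb3_lipschitz[OF F, of "Y t []" "Y s []"]
    mult_left_mono[OF increment_bounds(2) Cb3_norm_bounds(4)[OF F]]
  unfolding \<delta>_def by (auto intro: order_trans)

lemma F''_sym: "F'' x v w = F'' x w v"
  by (rule second_derivative_symmetric[OF Cb3_derivatives(1,2)[OF F] Cb3_lipschitz(2)[OF F] fderiv_bounds(1)])

lemma F''_q_q:
  "F'' y q q = 2 *\<^sub>R (\<Sum>a\<in>UNIV. \<Sum>b\<in>UNIV. X s t [bullet a, bullet b] *\<^sub>R F'' y (Y s [bullet a]) (Y s [bullet b]))"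
proof -
  let ?G = "\<lambda>a b. F'' y (Y s [bullet a]) (Y s [bullet b])"
  have "F'' y q q = (\<Sum>a\<in>UNIV. \<Sum>b\<in>UNIV. (X s t [bullet a] * X s t [bullet b]) *\<^sub>R ?G a b)"
    unfolding q_def by (simp add: blinfun.sum_left blinfun.sum_right blinfun.scaleR_left blinfun.scaleR_right
      scaleR_sum_right) (subst sum.swap, simp add: mult.commute)
  also have "\<dots> = (\<Sum>a\<in>UNIV. \<Sum>b\<in>UNIV. X s t [bullet a, bullet b] *\<^sub>R ?G a b) +
      (\<Sum>a\<in>UNIV. \<Sum>b\<in>UNIV. X s t [bullet b, bullet a] *\<^sub>R ?G a b)"
    by (simp add: shuffle scaleR_left_distrib sum.distrib)
  \<comment> \<open>Swapping the sums exchanges the roles of \<open>a\<close> and \<open>b\<close>,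
    which \<open>F''\<close> does not see by symmetry.\<close>
  also have "(\<Sum>a\<in>UNIV. \<Sum>b\<in>UNIV. X s t [bullet b, bullet a] *\<^sub>R ?G a b) =
      (\<Sum>a\<in>UNIV. \<Sum>b\<in>UNIV. X s t [bullet a, bullet b] *\<^sub>R ?G a b)"
    by (subst sum.swap, intro sum.cong refl, subst F''_sym, rule refl)
  finally show ?thesis
    by (simp add: scaleR_2)
qed

text \<open>\<open>F'\<close> applied to the expansion of \<delta> accounts for all terms of the
  remainder with \<open>F'\<close> and leaves \<open>F' ?y ?r\<close>. The correction in the pair
  coefficients is half of \<open>F'' ?y q q\<close>; replacing it by the Taylor term in \<delta>
  costs order u^3 only, because \<open>\<delta> - q\<close> is of order u^2. The factor 3 counts the
  pieces.\<close>

lemma remainder_compose_empty: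
  "norm (remainder X (compose_controlled F Y) [] s t) \<le> 3 * (B * L ^ 3 * u ^ 3)"
proof -
  let ?y = "Y s []"
  let ?T = "F (Y t []) - F ?y - F' ?y \<delta> - (1/2) *\<^sub>R F'' ?y \<delta> \<delta>"
  let ?r = "remainder X Y [] s t"
  let ?H = "F'' ?y (\<delta> - q) \<delta> + F'' ?y q (\<delta> - q)"
  have rem: "remainder X (compose_controlled F Y) [] s t = ?T + F' ?y ?r + (1/2) *\<^sub>R ?H"
  proof -
    have H: "?H = F'' ?y \<delta> \<delta> - F'' ?y q q"
      by (simp add: blinfun.bilinear_simps)
    show ?thesis
      unfolding H F''_q_q
      by (simp add: \<delta>_def blinfun.diff_right blinfun.sum_right blinfun.scaleR_right scaleR_right_diff_distrib
        scaleR_add_right sum.distrib)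
  qed
  have "norm ?T \<le> B * norm \<delta> ^ 3"
    using quadratic_taylor_error[OF Cb3_derivatives(1,2)[OF F] Cb3_lipschitz(2)[OF F] fderiv_bounds(1)]
    by (simp add: \<delta>_def)
  also have "\<dots> \<le> B * (L * u) ^ 3"
    using increment_bounds(2) fderiv_bounds(1) by (intro mult_left_mono power_mono) auto
  finally have T: "norm ?T \<le> B * L ^ 3 * u ^ 3"
    by (simp add: power_mult_distrib)
  have "norm (F' ?y ?r) \<le> B * (P * u ^ 3)"
    by (intro norm_blinfun_le fderiv_bounds R0)
  also have "\<dots> = B * P * u ^ 3" by simp
  also have "\<dots> \<le> B * L ^ 3 * u ^ 3"
    using P_le_L L3 fderiv_bounds(1) u by (intro mult_right_mono mult_left_mono) auto
  finally have r: "norm (F' ?y ?r) \<le> B * L ^ 3 * u ^ 3" .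
  have "norm (F'' ?y (\<delta> - q) \<delta>) \<le> B * (L * u\<^sup>2) * (L * u)" "norm (F'' ?y q (\<delta> - q)) \<le> B * (L * u) * (L * u\<^sup>2)"
    by (intro norm_blinfun2_le fderiv_bounds increment_bounds)+
  moreover have "B * (L * L) * u ^ 3 \<le> B * L ^ 3 * u ^ 3"
    using L3 fderiv_bounds(1) u by (intro mult_right_mono mult_left_mono) auto
  ultimately have "norm ?H \<le> 2 * (B * L ^ 3 * u ^ 3)"
    using norm_triangle_ineq[of "F'' ?y (\<delta> - q) \<delta>" "F'' ?y q (\<delta> - q)"]
    by (simp add: power2_eq_square power3_eq_cube mult_ac)
  then have H: "norm ((1/2) *\<^sub>R ?H) \<le> B * L ^ 3 * u ^ 3"
    by simp
  show ?thesis
    unfolding rem using T r H norm_triangle_ineq[of "?T + F' ?y ?r" "(1/2) *\<^sub>R ?H"]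
      norm_triangle_ineq[of ?T "F' ?y ?r"] by linarith
qed

text \<open>Here \<open>F'\<close> is linearized. The corrections in the pair coefficients, weighted
  by the first-order entries of X, add up to \<open>F'' ?y q (Y s [bullet a])\<close>. This differs
  from \<open>F'' ?y \<delta> (Y t [bullet a])\<close> by \<open>?H1\<close> and \<open>?H2\<close>,
  both of order u^2.\<close>

lemma remainder_compose_bullet:
  "norm (remainder X (compose_controlled F Y) [bullet a] s t) \<le> 4 * (B * L ^ 3 * u\<^sup>2)"
proof -
  let ?y = "Y s []"
  let ?r = "remainder X Y [bullet a] s t"
  let ?G = "(F' (Y t []) - F' ?y - F'' ?y \<delta>) (Y t [bullet a])"
  let ?H1 = "F'' ?y (\<delta> - q) (Y t [bullet a])"
  let ?H2 = "F'' ?y q (Y t [bullet a] - Y s [bullet a])"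
  have rem: "remainder X (compose_controlled F Y) [bullet a] s t = ?G + ?H1 + ?H2 + F' ?y ?r"
  proof -
    have "F'' ?y q (Y s [bullet a]) = (\<Sum>b\<in>UNIV. X s t [bullet b] *\<^sub>R F'' ?y (Y s [bullet b]) (Y s [bullet a]))"
      by (simp add: q_def blinfun.sum_left blinfun.sum_right blinfun.scaleR_left blinfun.scaleR_right)
    then show ?thesis
      by (simp add: blinfun.diff_left blinfun.diff_right blinfun.add_right blinfun.sum_right blinfun.scaleR_right
        scaleR_add_right sum.distrib)
  qed
  have LL: "B * (L * L) * u\<^sup>2 \<le> B * L ^ 3 * u\<^sup>2" "B * L * u\<^sup>2 \<le> B * L ^ 3 * u\<^sup>2"
    using L3 fderiv_bounds(1) u by (auto intro!: mult_right_mono mult_left_mono)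
  have Yt: "norm (Y t [bullet a]) \<le> L"
    using Y1[of t a] P_le_L by simp
  have "norm (F' (Y t []) - F' ?y - F'' ?y \<delta>) \<le> B * (norm \<delta>)\<^sup>2"
    using linearization_error[OF Cb3_derivatives(2)[OF F] Cb3_lipschitz(2)[OF F] fderiv_bounds(1)]
    by (simp add: \<delta>_def)
  also have "\<dots> \<le> B * (L * u)\<^sup>2"
    using increment_bounds(2) fderiv_bounds(1) by (intro mult_left_mono power_mono) auto
  finally have "norm ?G \<le> B * (L * u)\<^sup>2 * L"
    using Yt fderiv_bounds(1) by (intro norm_blinfun_le) auto
  then have G: "norm ?G \<le> B * L ^ 3 * u\<^sup>2"
    by (simp add: power2_eq_square power3_eq_cube mult_ac)
  have "norm ?H1 \<le> B * (L * u\<^sup>2) * L" "norm ?H2 \<le> B * (L * u) * (L * u)"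
    by (intro norm_blinfun2_le fderiv_bounds increment_bounds Yt)+
  then have H: "norm ?H1 \<le> B * L ^ 3 * u\<^sup>2" "norm ?H2 \<le> B * L ^ 3 * u\<^sup>2"
    using LL by (auto simp: power2_eq_square mult_ac)
  have "norm ?r \<le> L * u\<^sup>2"
    using R1[of a] mult_right_mono[OF P_le_L, of "u\<^sup>2"] by simp
  then have "norm (F' ?y ?r) \<le> B * (L * u\<^sup>2)"
    by (intro norm_blinfun_le fderiv_bounds)
  then have r: "norm (F' ?y ?r) \<le> B * L ^ 3 * u\<^sup>2"
    using LL by (simp add: mult_ac)
  show ?thesis
    unfolding rem using G H r norm_triangle_ineq[of "?G + ?H1 + ?H2" "F' ?y ?r"]
      norm_triangle_ineq[of "?G + ?H1" ?H2] norm_triangle_ineq[of ?G ?H1] by linarith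
qed

text \<open>Shared by the two kinds of forests of order 2, whose remainders are plain increments:
  first \<open>F'\<close> changes, then the vector.\<close>

lemma fderiv_increment:
  assumes "norm v' \<le> P" "norm (v' - v) \<le> P * u"
  shows "norm (F' (Y t []) v' - F' (Y s []) v) \<le> 2 * (B * L ^ 3 * u)"
proof -
  have L0: "0 \<le> L"
    using L_ge_1 by simp
  have "norm ((F' (Y t []) - F' (Y s [])) v') \<le> B * (L * u) * L"
    using assms P_le_L L0 u fderiv_bounds(1) by (intro norm_blinfun_le fderiv_bounds) auto
  moreover have "norm (F' (Y s []) (v' - v)) \<le> B * (L * u)"
    using assms mult_right_mono[OF P_le_L u(1)] by (intro norm_blinfun_le fderiv_bounds) auto
  moreover have "B * (L * L) * u \<le> B * L ^ 3 * u" "B * L * u \<le> B * L ^ 3 * u"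
    using L3 fderiv_bounds(1) u by (auto intro!: mult_right_mono mult_left_mono)
  moreover have "F' (Y t []) v' - F' (Y s []) v = (F' (Y t []) - F' (Y s [])) v' + F' (Y s []) (v' - v)"
    by (simp add: blinfun.bilinear_simps)
  ultimately show ?thesis
    using norm_triangle_ineq[of "(F' (Y t []) - F' (Y s [])) v'" "F' (Y s []) (v' - v)"]
    by (simp add: mult_ac)
qed

lemma remainder_compose_branch:
  "norm (remainder X (compose_controlled F Y) [Node a [bullet b]] s t) \<le> 2 * (B * L ^ 3 * u)"
  using fderiv_increment[OF Y3[of t] R3[of a b, simplified]] by simp

text \<open>The term with \<open>F''\<close> is a product of three factors, changed one at a time in
  \<open>?H1\<close>, \<open>?H2\<close> and \<open>?H3\<close>; the term with \<open>F'\<close>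
  contributes 2 to the constant 5.\<close>

lemma remainder_compose_pair:
  "norm (remainder X (compose_controlled F Y) [bullet a, bullet b] s t) \<le> 5 * (B * L ^ 3 * u)"
proof -
  let ?c = "\<lambda>r a. Y r [bullet a]" and ?y = "Y s []" and ?y' = "Y t []"
  let ?E = "F' ?y' (Y t [bullet a, bullet b]) - F' ?y (Y s [bullet a, bullet b])"
  let ?H1 = "(F'' ?y' - F'' ?y) (?c t a) (?c t b)"
  let ?H2 = "F'' ?y (?c t a - ?c s a) (?c t b)"
  let ?H3 = "F'' ?y (?c s a) (?c t b - ?c s b)"
  have rem: "remainder X (compose_controlled F Y) [bullet a, bullet b] s t = ?E + ?H1 + ?H2 + ?H3"
    by (simp add: blinfun.bilinear_simps)
  have L0: "0 \<le> L"
    using L_ge_1 by simp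
  have LL: "B * (L * L) * u \<le> B * L ^ 3 * u"
    using L3 fderiv_bounds(1) u by (auto intro!: mult_right_mono mult_left_mono)
  have c: "norm (?c r a) \<le> L" if "r \<in> {s, t}" for r a
    using Y1[OF that, of a] P_le_L by simp
  have "norm ?H1 \<le> B * (L * u) * L * L" "norm ?H2 \<le> B * (L * u) * L" "norm ?H3 \<le> B * L * (L * u)"
    using L0 u fderiv_bounds(1) by (intro norm_blinfun2_le fderiv_bounds increment_bounds c; simp)+
  then have "norm ?H1 \<le> B * L ^ 3 * u" "norm ?H2 \<le> B * L ^ 3 * u" "norm ?H3 \<le> B * L ^ 3 * u"
    using LL by (simp_all add: power3_eq_cube mult_ac)
  moreover have "norm ?E \<le> 2 * (B * L ^ 3 * u)"
    using fderiv_increment[OF Y2[of t] R2[of a b, simplified]] by simp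
  ultimately show ?thesis
    unfolding rem using norm_triangle_ineq[of "?E + ?H1 + ?H2" ?H3]
      norm_triangle_ineq[of "?E + ?H1" ?H2] norm_triangle_ineq[of ?E ?H1] by linarith
qed

text \<open>5 is the largest of the four constants 3, 4, 5 and 2; \<open>nonneg\<close> allows the
  others to be enlarged.\<close>

lemma remainder_compose_bound:
  assumes "\<tau> \<in> forests_upto 2"
  shows "norm (remainder X (compose_controlled F Y) \<tau> s t) \<le> 5 * (B * L ^ 3 * u ^ (3 - forest_order \<tau>))"
proof -
  have "0 \<le> B * L ^ 3 * u ^ k" for k
    using fderiv_bounds(1) L_ge_1 u by simp
  note nonneg = this[of 1] this[of 2] this[of 3]
  show ?thesis
    using assms
  proof (cases rule: forests_upto_2_cases)
    case 1
    then show ?thesis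
      using remainder_compose_empty nonneg(3) by (simp add: forest_order_def del: remainder.simps)
  next
    case (2 a)
    then show ?thesis
      using remainder_compose_bullet[of a] nonneg(2) by (simp add: forest_order_def del: remainder.simps)
  next
    case (3 a b)
    then show ?thesis
      using remainder_compose_pair[of a b] by (simp add: forest_order_def del: remainder.simps)
  next
    case (4 a b)
    then show ?thesis
      using remainder_compose_branch[of a b] nonneg(1) by (simp add: forest_order_def del: remainder.simps)
  qed
qed

end

subsection \<open>Global bounds\<close>

text \<open>Passing to the base \<open>1 + T\<close>, which is at least 1, makes the power monotone
  in the exponent and the bound linear in \<open>T\<close>.\<close>

lemma powr_le_one_plus:
  assumes "0 \<le> h" "h \<le> T" "0 \<le> \<alpha>" "\<alpha> \<le> (1::real)"
  shows "h powr \<alpha> \<le> 1 + T"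
proof -
  have "h powr \<alpha> \<le> (1 + T) powr \<alpha>"
    using assms by (intro powr_mono2) auto
  also have "\<dots> \<le> (1 + T) powr 1"
    using assms by (intro powr_mono) auto
  finally show ?thesis
    using assms by simp
qed

lemma PBRP_bound:
  fixes X :: "'a::finite rough_path"
  assumes "0 < T" "X \<in> PBRP \<alpha> T" "forest_order \<tau> \<le> 3" "\<tau> \<noteq> []"
    and "s \<in> {0..T}" "t \<in> {0..T}" "s \<noteq> t"
  shows "\<bar>X s t \<tau>\<bar> \<le> rp_norm \<alpha> T X * (\<bar>t - s\<bar> powr \<alpha>) ^ forest_order \<tau>"
proof -
  let ?h = "\<lambda>\<tau>. holder_norm T (real (forest_order \<tau>) * \<alpha>) (\<lambda>s t. X s t \<tau>)"
  have fin: "holder_finite T (real (forest_order \<sigma>) * \<alpha>) (\<lambda>s t. X s t \<sigma>)" if "\<sigma> \<in> forests_upto 3" for \<sigma>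
    using assms(2) that by (auto simp: PBRP_def)
  have "\<tau> \<in> forests_upto 3 - {[]}"
    using assms(3,4) by (simp add: forests_upto_def)
  then have "?h \<tau> \<le> rp_norm \<alpha> T X"
    unfolding rp_norm_def using holder_norm_nonneg[OF assms(1) fin]
    by (intro member_le_sum) (auto simp: finite_forests_upto)
  moreover have "\<bar>X s t \<tau>\<bar> \<le> ?h \<tau> * \<bar>t - s\<bar> powr (real (forest_order \<tau>) * \<alpha>)"
    using holder_norm_bound[OF fin assms(5-7), of \<tau>] assms(3) by (simp add: forests_upto_def)
  moreover have "\<bar>t - s\<bar> powr (real (forest_order \<tau>) * \<alpha>) = (\<bar>t - s\<bar> powr \<alpha>) ^ forest_order \<tau>"
    using assms(7) by (simp add: powr_power mult.commute)
  ultimately show ?thesis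
    by (smt (verit) mult_right_mono powr_ge_zero)
qed

lemma rp_norm_nonneg:
  assumes "0 < T" "X \<in> PBRP \<alpha> T"
  shows "0 \<le> rp_norm \<alpha> T X"
  unfolding rp_norm_def using assms by (auto intro!: sum_nonneg holder_norm_nonneg simp: PBRP_def)

lemma controlled_norm_nonneg:
  assumes "0 < T" "Y \<in> controlled \<alpha> T X"
  shows "0 \<le> controlled_norm \<alpha> T X Y"
  unfolding controlled_norm_def using assms by (auto intro!: sum_nonneg holder_norm_nonneg simp: controlled_def)

text \<open>For order at most 2 the truncated subtraction of natural numbers agrees with the real
  one.\<close>

lemma holder_exponent_eq:
  assumes "\<tau> \<in> forests_upto 2" "h \<noteq> 0"
  shows "\<bar>h\<bar> powr ((3 - real (forest_order \<tau>)) * \<alpha>) = (\<bar>h\<bar> powr \<alpha>) ^ (3 - forest_order \<tau>)"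
  using assms by (simp add: powr_power forests_upto_def of_nat_diff mult.commute)

lemma controlled_bound:
  assumes "0 < T" "Y \<in> controlled \<alpha> T X" "\<tau> \<in> forests_upto 2" "s \<in> {0..T}" "t \<in> {0..T}" "s \<noteq> t"
  shows "norm (remainder X Y \<tau> s t) \<le> controlled_norm \<alpha> T X Y * (\<bar>t - s\<bar> powr \<alpha>) ^ (3 - forest_order \<tau>)"
proof -
  let ?h = "\<lambda>\<tau>. holder_norm T ((3 - real (forest_order \<tau>)) * \<alpha>) (remainder X Y \<tau>)"
  have fin: "holder_finite T ((3 - real (forest_order \<sigma>)) * \<alpha>) (remainder X Y \<sigma>)" if "\<sigma> \<in> forests_upto 2" for \<sigma>
    using assms(2) that by (auto simp: controlled_def)
  have "?h \<tau> \<le> controlled_norm \<alpha> T X Y"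
    unfolding controlled_norm_def using holder_norm_nonneg[OF assms(1) fin] assms(3)
    by (intro member_le_sum) (auto simp: finite_forests_upto)
  moreover have "norm (remainder X Y \<tau> s t) \<le> ?h \<tau> * \<bar>t - s\<bar> powr ((3 - real (forest_order \<tau>)) * \<alpha>)"
    using holder_norm_bound[OF fin assms(4-6)] assms(3) .
  ultimately show ?thesis
    using holder_exponent_eq[OF assms(3), of "t - s" \<alpha>] assms(6) by (smt (verit) mult_right_mono powr_ge_zero)
qed

lemma controlled_normI:
  fixes Z :: "('a::finite, 'n::finite) controlled_path"
  assumes "0 < T"
    and bound: "\<And>\<tau> s t. \<tau> \<in> forests_upto 2 \<Longrightarrow> s \<in> {0..T} \<Longrightarrow> t \<in> {0..T} \<Longrightarrow> s \<noteq> t \<Longrightarrow>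
      norm (remainder X Z \<tau> s t) \<le> K * (\<bar>t - s\<bar> powr \<alpha>) ^ (3 - forest_order \<tau>)"
  shows "Z \<in> controlled \<alpha> T X"
    and "controlled_norm \<alpha> T X Z \<le> real (card (forests_upto 2 :: 'a forest set)) * K"
proof -
  have *: "norm (remainder X Z \<tau> s t) \<le> K * \<bar>t - s\<bar> powr ((3 - real (forest_order \<tau>)) * \<alpha>)"
    if "\<tau> \<in> forests_upto 2" "s \<in> {0..T}" "t \<in> {0..T}" "s \<noteq> t" for \<tau> s t
    using bound[OF that] holder_exponent_eq[OF that(1), of "t - s" \<alpha>] that(4) by simp
  show "Z \<in> controlled \<alpha> T X"
    unfolding controlled_def using holder_normI(1)[OF assms(1) *] by blast
  show "controlled_norm \<alpha> T X Z \<le> real (card (forests_upto 2 :: 'a forest set)) * K"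
    unfolding controlled_norm_def by (intro sum_bounded_above holder_normI(2)[OF assms(1) *])
qed

section \<open>A priori bounds in terms of S\<close>

context
  fixes \<alpha> T :: real and X :: "'a::finite rough_path" and Y :: "('a, 'n::finite) controlled_path" and S :: real
  assumes \<alpha>: "0 \<le> \<alpha>" "\<alpha> \<le> 1" and T: "0 < T" and X: "X \<in> PBRP \<alpha> T" and Y: "Y \<in> controlled \<alpha> T X"
  defines "S \<equiv> 1 + T + (\<Sum>a\<in>UNIV. norm (Y 0 [bullet a]))
    + (\<Sum>a\<in>UNIV. \<Sum>b\<in>UNIV. norm (Y 0 [bullet a, bullet b]))
    + (\<Sum>a\<in>UNIV. \<Sum>b\<in>UNIV. norm (Y 0 [Node a [bullet b]]))
    + controlled_norm \<alpha> T X Y + rp_norm \<alpha> T X"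
begin

lemma data_le_S:
  "1 + T \<le> S" "norm (Y 0 [bullet a]) \<le> S" "norm (Y 0 [bullet a, bullet b]) \<le> S"
  "norm (Y 0 [Node a [bullet b]]) \<le> S" "controlled_norm \<alpha> T X Y \<le> S" "rp_norm \<alpha> T X \<le> S"
proof -
  have double: "f a b \<le> (\<Sum>a\<in>UNIV. \<Sum>b\<in>UNIV. f a b)" if "\<And>a b. (0::real) \<le> f a b"
    for f :: "'a \<Rightarrow> 'a \<Rightarrow> real"
    using that member_le_sum[of b UNIV "f a"] member_le_sum[of a UNIV "\<lambda>a. \<Sum>b\<in>UNIV. f a b"]
    by (force intro: order_trans sum_nonneg)
  have "norm (Y 0 [bullet a]) \<le> (\<Sum>a\<in>UNIV. norm (Y 0 [bullet a]))"
    by (intro member_le_sum) auto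
  moreover have "norm (Y 0 [bullet a, bullet b]) \<le> (\<Sum>a\<in>UNIV. \<Sum>b\<in>UNIV. norm (Y 0 [bullet a, bullet b]))"
    by (rule double) simp
  moreover have "norm (Y 0 [Node a [bullet b]]) \<le> (\<Sum>a\<in>UNIV. \<Sum>b\<in>UNIV. norm (Y 0 [Node a [bullet b]]))"
    by (rule double) simp
  moreover note T rp_norm_nonneg[OF T X] controlled_norm_nonneg[OF T Y]
  ultimately show "1 + T \<le> S" "norm (Y 0 [bullet a]) \<le> S" "norm (Y 0 [bullet a, bullet b]) \<le> S"
    "norm (Y 0 [Node a [bullet b]]) \<le> S" "controlled_norm \<alpha> T X Y \<le> S" "rp_norm \<alpha> T X \<le> S"
    unfolding S_def by (smt (verit) norm_ge_zero)+
qed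

lemma S_ge_1: "1 \<le> S"
  using data_le_S(1) T by simp

lemma powr_le_S: "s \<in> {0..T} \<Longrightarrow> t \<in> {0..T} \<Longrightarrow> \<bar>t - s\<bar> powr \<alpha> \<le> S"
  using powr_le_one_plus[of "\<bar>t - s\<bar>" T \<alpha>] \<alpha> data_le_S(1) by force

lemma X_le_S:
  assumes "forest_order \<tau> \<le> 3" "\<tau> \<noteq> []" "s \<in> {0..T}" "t \<in> {0..T}" "s \<noteq> t"
  shows "\<bar>X s t \<tau>\<bar> \<le> S * (\<bar>t - s\<bar> powr \<alpha>) ^ forest_order \<tau>"
  using PBRP_bound[OF T X assms] data_le_S(6) by (meson mult_right_mono order_trans powr_ge_zero zero_le_power)

lemma remainder_le_S:
  assumes "\<tau> \<in> forests_upto 2" "s \<in> {0..T}" "t \<in> {0..T}" "s \<noteq> t"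
  shows "norm (remainder X Y \<tau> s t) \<le> S * (\<bar>t - s\<bar> powr \<alpha>) ^ (3 - forest_order \<tau>)"
  using controlled_bound[OF T Y assms] data_le_S(5) by (meson mult_right_mono order_trans powr_ge_zero zero_le_power)

text \<open>The remainder over the interval from 0 to \<open>r\<close> carries the initial data to
  time \<open>r\<close>. At order 2 it is a plain increment, giving S + S^2. At order 1 the sum over
  \<open>b\<close> involves only coefficients at time 0, giving S + S^3 + 2 d S^4 with d the number
  of decorations. The factor 6 leaves room.\<close>

lemma coefficient_bounds:
  assumes r: "r \<in> {0..T}"
  shows "norm (Y r [bullet a]) \<le> 6 * real CARD('a) * S ^ 4"
    and "norm (Y r [bullet a, bullet b]) \<le> 6 * real CARD('a) * S ^ 4"
    and "norm (Y r [Node a [bullet b]]) \<le> 6 * real CARD('a) * S ^ 4"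
proof -
  let ?D = "real CARD('a)" and ?u = "\<bar>r - 0\<bar> powr \<alpha>"
  have D: "1 \<le> ?D"
    by (rule one_le_card)
  have S: "S \<le> S ^ 4" "S\<^sup>2 \<le> S ^ 4" "S ^ 3 \<le> S ^ 4" "0 \<le> S ^ 4"
    using S_ge_1 power_increasing[of 1 4 S] by (auto intro!: power_increasing)
  have DS: "S ^ 4 \<le> ?D * S ^ 4"
    using D S mult_right_mono[of 1 ?D "S ^ 4"] by simp
  have u: "?u \<le> S" "0 \<le> ?u"
    using powr_le_S[of 0 r] r T by auto
  have "norm (Y r [bullet a]) \<le> 6 * ?D * S ^ 4 \<and> norm (Y r [bullet a, bullet b]) \<le> 6 * ?D * S ^ 4 \<and>
      norm (Y r [Node a [bullet b]]) \<le> 6 * ?D * S ^ 4"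
  \<comment> \<open>The Hoelder bounds speak of distinct times only.\<close>
  proof (cases "r = 0")
    case True
    show ?thesis
      unfolding True using data_le_S(2)[of a] data_le_S(3,4)[of a b] S DS by (intro conjI; linarith)
  next
    case False
    have mem: "[bullet a, bullet b] \<in> forests_upto 2" "[Node a [bullet b]] \<in> forests_upto 2" "[bullet a] \<in> forests_upto 2"
      by (auto simp: forests_upto_def forest_order_def)
    have r0: "0 \<in> {0..T}" "0 \<noteq> r" using T False by auto
    have Su: "S * ?u \<le> S\<^sup>2" "S * ?u\<^sup>2 \<le> S ^ 3"
      using u S_ge_1 power_mono[of ?u S 2] by (auto simp: power2_eq_square power3_eq_cube)
    have "norm (Y r [bullet a, bullet b] - Y 0 [bullet a, bullet b]) \<le> S\<^sup>2"
      using remainder_le_S[OF mem(1) r0(1) r r0(2)] Su by (simp add: forest_order_def)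
    then have e: "norm (Y r [bullet a, bullet b]) \<le> S + S\<^sup>2"
      using data_le_S(3)[of a b] norm_triangle_sub[of "Y r [bullet a, bullet b]" "Y 0 [bullet a, bullet b]"] by linarith
    have "norm (Y r [Node a [bullet b]] - Y 0 [Node a [bullet b]]) \<le> S\<^sup>2"
      using remainder_le_S[OF mem(2) r0(1) r r0(2)] Su by (simp add: forest_order_def)
    then have k: "norm (Y r [Node a [bullet b]]) \<le> S + S\<^sup>2"
      using data_le_S(4)[of a b] norm_triangle_sub[of "Y r [Node a [bullet b]]" "Y 0 [Node a [bullet b]]"] by linarith
    let ?E = "\<Sum>b\<in>UNIV. X 0 r [bullet b] *\<^sub>R (Y 0 [bullet b, bullet a] + Y 0 [Node a [bullet b]])"
    have X1: "\<bar>X 0 r [bullet b]\<bar> \<le> S\<^sup>2" for b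
      using X_le_S[of "[bullet b]" 0 r] r r0 Su by (simp add: forest_order_def)
    have "norm (Y 0 [bullet b, bullet a] + Y 0 [Node a [bullet b]]) \<le> 2 * S" for b
      using norm_triangle_mono[OF data_le_S(3)[of b a] data_le_S(4)[of a b]] by simp
    then have "norm ?E \<le> ?D * (S\<^sup>2 * (2 * S))"
      using X1 S_ge_1 by (auto intro!: norm_sum_UNIV_le mult_mono)
    also have "\<dots> = 2 * (?D * S ^ 3)"
      by (simp add: power2_eq_square power3_eq_cube)
    also have "?D * S ^ 3 \<le> ?D * S ^ 4"
      using S by (intro mult_left_mono) auto
    finally have E: "norm ?E \<le> 2 * (?D * S ^ 4)" by simp
    have R: "norm (remainder X Y [bullet a] 0 r) \<le> S ^ 3"
      using remainder_le_S[OF mem(3) r0(1) r r0(2)] Su by (simp add: forest_order_def)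
    have "norm (Y r [bullet a]) \<le> S + (S ^ 3 + 2 * (?D * S ^ 4))"
      using norm_triangle_mono[OF data_le_S(2)[of a] norm_triangle_mono[OF R E]] by simp
    then show ?thesis
      using e k S DS by linarith
  qed
  then show "norm (Y r [bullet a]) \<le> 6 * real CARD('a) * S ^ 4"
    and "norm (Y r [bullet a, bullet b]) \<le> 6 * real CARD('a) * S ^ 4"
    and "norm (Y r [Node a [bullet b]]) \<le> 6 * real CARD('a) * S ^ 4"
    by auto
qed

text \<open>The bound for the coefficients also dominates \<open>S\<close>, hence the Hoelder
  constants and the powers of the interval length, so it can serve as \<open>P\<close>.\<close>

lemma controlled_increment_S:
  assumes F: "F \<in> Cb3" and st: "s \<in> {0..T}" "t \<in> {0..T}" "s \<noteq> t"
  shows "controlled_increment X Y F s t (\<bar>t - s\<bar> powr \<alpha>) (6 * real CARD('a) * S ^ 4)"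
proof -
  let ?P = "6 * real CARD('a) * S ^ 4" and ?u = "\<bar>t - s\<bar> powr \<alpha>"
  have D: "1 \<le> real CARD('a)"
    by (rule one_le_card)
  have S4: "S \<le> S ^ 4"
    using S_ge_1 power_increasing[of 1 4 S] by simp
  then have SP: "S \<le> ?P"
    using mult_right_mono[OF D, of "S ^ 4"] S_ge_1 by linarith
  have X_bound: "\<bar>X s t \<tau>\<bar> \<le> ?P * ?u ^ forest_order \<tau>" if "forest_order \<tau> \<le> 3" "\<tau> \<noteq> []" for \<tau>
    using X_le_S[OF that st] mult_right_mono[OF SP, of "?u ^ forest_order \<tau>"] by simp
  have R_bound: "norm (remainder X Y \<tau> s t) \<le> ?P * ?u ^ (3 - forest_order \<tau>)" if "\<tau> \<in> forests_upto 2" for \<tau>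
    using remainder_le_S[OF that st] mult_right_mono[OF SP, of "?u ^ (3 - forest_order \<tau>)"] by simp
  show ?thesis
  proof
    show "F \<in> Cb3" by fact
    show "1 \<le> ?P" "0 \<le> ?u" "?u \<le> ?P"
      using S_ge_1 SP powr_le_S[OF st(1,2)] by auto
    show "\<bar>X s t [bullet a]\<bar> \<le> ?P * ?u" "\<bar>X s t [bullet a, bullet b]\<bar> \<le> ?P * ?u\<^sup>2"
      "\<bar>X s t [Node a [bullet b]]\<bar> \<le> ?P * ?u\<^sup>2" for a b
      using X_bound[of "[bullet a]"] X_bound[of "[bullet a, bullet b]"] X_bound[of "[Node a [bullet b]]"]
      by (simp_all add: forest_order_def numeral_2_eq_2)
    show "X s t [bullet a] * X s t [bullet b] = X s t [bullet a, bullet b] + X s t [bullet b, bullet a]" for a b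
    proof -
      have "forest_order [bullet a] + forest_order [bullet b] \<le> 3"
        by (simp add: forest_order_def)
      \<comment> \<open>Two one-letter words shuffle into their two orders, counted twice if the
        letters agree.\<close>
      then have "(\<Sum>\<rho>\<in>#shuffle [bullet a] [bullet b]. X s t \<rho>) = X s t [bullet a] * X s t [bullet b]"
        using X st unfolding PBRP_def by blast
      then show ?thesis by simp
    qed
    show "norm (Y r [bullet a]) \<le> ?P" "norm (Y r [bullet a, bullet b]) \<le> ?P"
      "norm (Y r [Node a [bullet b]]) \<le> ?P" if "r \<in> {s, t}" for r a b
      using that st coefficient_bounds[of r a] coefficient_bounds(2,3)[of r a b] by blast+
    show "norm (remainder X Y [] s t) \<le> ?P * ?u ^ 3" "norm (remainder X Y [bullet a] s t) \<le> ?P * ?u\<^sup>2"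
      "norm (remainder X Y [bullet a, bullet b] s t) \<le> ?P * ?u"
      "norm (remainder X Y [Node a [bullet b]] s t) \<le> ?P * ?u" for a b
      using R_bound[of "[]"] R_bound[of "[bullet a]"] R_bound[of "[bullet a, bullet b]"] R_bound[of "[Node a [bullet b]]"]
      by (simp_all add: forests_upto_def forest_order_def del: remainder.simps)
  qed
qed

text \<open>\<open>K\<close> is \<open>5 * (B * L ^ 3)\<close> with the values of \<open>L\<close>
  and \<open>P\<close> inserted; the norm sums one seminorm for each forest.\<close>

lemma compose_controlled_bound:
  assumes F: "F \<in> Cb3"
  defines "K \<equiv> 5 * (Cb3_norm F * (4 * (real CARD('a))\<^sup>2 * (6 * real CARD('a) * S ^ 4) ^ 3) ^ 3)"
  shows "compose_controlled F Y \<in> controlled \<alpha> T X"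
    and "controlled_norm \<alpha> T X (compose_controlled F Y) \<le> real (card (forests_upto 2 :: 'a forest set)) * K"
proof -
  have "norm (remainder X (compose_controlled F Y) \<tau> s t) \<le> K * (\<bar>t - s\<bar> powr \<alpha>) ^ (3 - forest_order \<tau>)"
    if "\<tau> \<in> forests_upto 2" "s \<in> {0..T}" "t \<in> {0..T}" "s \<noteq> t" for \<tau> s t
    using controlled_increment.remainder_compose_bound[OF controlled_increment_S[OF F that(2-4)] that(1)]
    unfolding K_def by (simp add: mult_ac)
  note controlled_normI[OF T this]
  then show "compose_controlled F Y \<in> controlled \<alpha> T X"
    and "controlled_norm \<alpha> T X (compose_controlled F Y) \<le> real (card (forests_upto 2 :: 'a forest set)) * K"
    by auto
qed

end

section \<open>The function M\<close>

lemma increasing_in_each_power_sum: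
  assumes "0 < C" "0 < n"
  shows "increasing_in_each (\<lambda>u v w x y z. C * (1 + u + v + w + x + y + z) ^ n)"
  unfolding increasing_in_each_def strict_mono_on_def using assms
  by (auto intro!: mult_strict_left_mono power_strict_mono)

theorem theorem2p8:
  fixes \<alpha> :: real
  assumes "1/4 < \<alpha>" and "\<alpha> \<le> 1/3"
  shows "\<exists>M :: real \<Rightarrow> real \<Rightarrow> real \<Rightarrow> real \<Rightarrow> real \<Rightarrow> real \<Rightarrow> real.
    increasing_in_each M \<and>
    (\<forall>(T::real) (X :: 'a::finite rough_path) (F :: real ^ 'n::finite \<Rightarrow> real ^ 'n)
       (Y :: ('a, 'n) controlled_path).
      T > 0 \<and> X \<in> PBRP \<alpha> T \<and> F \<in> Cb3 \<and> Y \<in> controlled \<alpha> T X \<longrightarrow>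
      compose_controlled F Y \<in> controlled \<alpha> T X \<and>
      controlled_norm \<alpha> T X (compose_controlled F Y) \<le>
        4 * (real CARD('a))\<^sup>2 * Cb3_norm F *
        M T
          (\<Sum>a\<in>UNIV. norm (Y 0 [bullet a]))
          (\<Sum>a\<in>UNIV. \<Sum>b\<in>UNIV. norm (Y 0 [bullet a, bullet b]))
          (\<Sum>a\<in>UNIV. \<Sum>b\<in>UNIV. norm (Y 0 [Node a [bullet b]]))
          (controlled_norm \<alpha> T X Y)
          (rp_norm \<alpha> T X))"
proof -
  let ?D = "real CARD('a)"
  \<comment> \<open>This is 1 + d + 2 d^2 for d decorations.\<close>
  define N where "N = real (card (forests_upto 2 :: 'a forest set))"
  define c where "c = (4 * ?D\<^sup>2 * (6 * ?D) ^ 3) ^ 3"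
  \<comment> \<open>The division leaves room for the prefactor \<open>4 * ?D\<^sup>2\<close> of the
    claim. \<open>C\<close> depends on the number of decorations alone.\<close>
  define C where "C = 5 * N * c / (4 * ?D\<^sup>2)"
  have "[] \<in> (forests_upto 2 :: 'a forest set)"
    by (simp add: forests_upto_def forest_order_def)
  then have "0 < N"
    unfolding N_def using finite_forests_upto[of 2] by (auto simp: card_gt_0_iff)
  then have C: "0 < C"
    unfolding C_def c_def by simp
  show ?thesis
  proof (intro exI[of _ "\<lambda>u v w x y z. C * (1 + u + v + w + x + y + z) ^ 36"] conjI allI impI)
    show "increasing_in_each (\<lambda>u v w x y z. C * (1 + u + v + w + x + y + z) ^ 36)"
      using C by (rule increasing_in_each_power_sum) simp
    fix T :: real and X :: "'a rough_path" and F :: "real ^ 'n \<Rightarrow> real ^ 'n" and Y :: "('a, 'n) controlled_path"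
    assume *: "T > 0 \<and> X \<in> PBRP \<alpha> T \<and> F \<in> Cb3 \<and> Y \<in> controlled \<alpha> T X"
    have \<alpha>: "0 \<le> \<alpha>" "\<alpha> \<le> 1"
      using assms by auto
    from * have "T > 0" "X \<in> PBRP \<alpha> T" "Y \<in> controlled \<alpha> T X" "F \<in> Cb3"
      by auto
    note Z = compose_controlled_bound[OF \<alpha> this]
    show "compose_controlled F Y \<in> controlled \<alpha> T X"
      by (rule Z(1))
    \<comment> \<open>\<open>S\<close> enters \<open>P\<close> with power 4, and passing to
      \<open>L\<close> and then to its cube triples the power twice; \<open>c\<close> collects the
      numerical factors.\<close>
    have scale: "N * (5 * (Cb3_norm F * (4 * ?D\<^sup>2 * (6 * ?D * S ^ 4) ^ 3) ^ 3)) =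
        4 * ?D\<^sup>2 * Cb3_norm F * (C * S ^ 36)" for S
    proof -
      have "(4 * ?D\<^sup>2 * (6 * ?D * S ^ 4) ^ 3) ^ 3 = c * S ^ 36"
        unfolding c_def by (simp only: power_mult_distrib power_mult[symmetric]) simp
      then show ?thesis
        unfolding C_def by simp
    qed
    show "controlled_norm \<alpha> T X (compose_controlled F Y) \<le> 4 * ?D\<^sup>2 * Cb3_norm F *
        (C * (1 + T + (\<Sum>a\<in>UNIV. norm (Y 0 [bullet a]))
          + (\<Sum>a\<in>UNIV. \<Sum>b\<in>UNIV. norm (Y 0 [bullet a, bullet b]))
          + (\<Sum>a\<in>UNIV. \<Sum>b\<in>UNIV. norm (Y 0 [Node a [bullet b]]))
          + controlled_norm \<alpha> T X Y + rp_norm \<alpha> T X) ^ 36)"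
      unfolding scale[symmetric] N_def by (rule Z(2))
  qed
qed

end
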